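(* Let $D$ and $E$ be dominated dcpos. The following are equivalent: (1) $D\cong E$; (2) $\Gamma(D)\cong\Gamma(E)$; (3) $\mathsf{Irr}(D)\cong\mathsf{Irr}(E)$ (all isomorphisms being order isomorphisms).
   Context: For a dcpo $D$, $\Gamma(D)$ denotes the complete lattice of Scott-closed subsets of $D$ ordered by inclusion. A subset of $D$ is irreducible if it is nonempty and whenever it is contained in a union $B\cup C$ of two Scott-closed sets it is contained in $B$ or in $C$; "closed irreducible" means Scott-closed and irreducible. $\mathsf{Irr}(D)$ denotes the set of closed irreducible subsets of $D$ ordered by inclusion. For $A',A\in\mathsf{Irr}(D)$ write $A'\triangleleft A$ if there is $x\in A$ with $A'\subseteq{\downarrow}x$, and $\nabla A=\{A'\in\mathsf{Irr}(D)\mid A'\triangleleft A\}$. A dcpo $D$ is dominated if for every $A\in\mathsf{Irr}(D)$ the collection $\nabla A$ is Scott-closed in the poset $\mathsf{Irr}(D)$. *)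

theory Defs
  imports Main "HOL-Library.Lub_Glb"
begin

text \<open>
  A poset is given by a carrier set \<open>P :: 'a::order set\<close> carrying the order induced from its type.
  Every poset (the empty one included) arises in this way, and \<open>\<Gamma>(D)\<close> and \<open>Irr(D)\<close> are
  carriers of type \<open>'a set set\<close>, automatically ordered by inclusion. All notions below are relative
  to the carrier; in particular \<open>isLub P S x\<close> says that \<open>x \<in> P\<close> is least among the upper bounds
  of \<open>S\<close> that lie in \<open>P\<close>.
\<close>

definition directed :: "'a::order set \<Rightarrow> bool" where
  "directed S \<longleftrightarrow> S \<noteq> {} \<and> (\<forall>x\<in>S. \<forall>y\<in>S. \<exists>z\<in>S. x \<le> z \<and> y \<le> z)"

definition dcpo :: "'a::order set \<Rightarrow> bool" where
  "dcpo D \<longleftrightarrow> (\<forall>S\<subseteq>D. directed S \<longrightarrow> (\<exists>x. isLub D S x))"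

text \<open>
  Scott-closedness is needed for arbitrary posets \<open>P\<close>, since it is also applied to \<open>Irr(D)\<close>:
  only those directed suprema that exist in \<open>P\<close> are considered.
\<close>

definition Scott_closed :: "'a::order set \<Rightarrow> 'a set \<Rightarrow> bool" where
  "Scott_closed P A \<longleftrightarrow> A \<subseteq> P \<and>
     (\<forall>x\<in>A. \<forall>y\<in>P. y \<le> x \<longrightarrow> y \<in> A) \<and>
     (\<forall>S\<subseteq>A. \<forall>x. directed S \<longrightarrow> isLub P S x \<longrightarrow> x \<in> A)"

definition Gam :: "'a::order set \<Rightarrow> 'a set set" (\<open>\<Gamma>\<close>) where
  "\<Gamma> D = {A. Scott_closed D A}"

definition irreducible_in :: "'a::order set \<Rightarrow> 'a set \<Rightarrow> bool" where
  "irreducible_in D A \<longleftrightarrow> A \<subseteq> D \<and> A \<noteq> {} \<and>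
     (\<forall>B C. Scott_closed D B \<longrightarrow> Scott_closed D C \<longrightarrow> A \<subseteq> B \<union> C \<longrightarrow> A \<subseteq> B \<or> A \<subseteq> C)"

definition Irr :: "'a::order set \<Rightarrow> 'a set set" where
  "Irr D = {A. Scott_closed D A \<and> irreducible_in D A}"

definition below_in :: "'a::order set \<Rightarrow> 'a set \<Rightarrow> 'a set \<Rightarrow> bool" where
  "below_in D A' A \<longleftrightarrow> (\<exists>x\<in>A. A' \<subseteq> {y \<in> D. y \<le> x})"

definition nabla :: "'a::order set \<Rightarrow> 'a set \<Rightarrow> 'a set set" where
  "nabla D A = {A' \<in> Irr D. below_in D A' A}"

definition dominated :: "'a::order set \<Rightarrow> bool" where
  "dominated D \<longleftrightarrow> (\<forall>A\<in>Irr D. Scott_closed (Irr D) (nabla D A))"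

definition order_isomorphic :: "'a::order set \<Rightarrow> 'b::order set \<Rightarrow> bool" (infix \<open>\<cong>\<^sub>o\<close> 50) where
  "P \<cong>\<^sub>o Q \<longleftrightarrow> (\<exists>f. bij_betw f P Q \<and> (\<forall>x\<in>P. \<forall>y\<in>P. x \<le> y \<longleftrightarrow> f x \<le> f y))"

end

theory Submission
  imports Defs
begin

text \<open>
  Everything is recovered from intrinsic order properties. \<open>Irr(D)\<close> consists of the join-prime
  elements of \<open>\<Gamma>(D)\<close>. Inside \<open>Irr(D)\<close>, the principal ideals, which form a copy of \<open>D\<close>, are
  the elements \<open>A\<close> belonging to every closed irreducible subset of the poset \<open>Irr(D)\<close> whose
  supremum is above \<open>A\<close>. Indeed, if \<open>\<C>\<close> is closed irreducible in \<open>Irr(D)\<close>, then \<open>\<Union>\<C>\<close> is closed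
  irreducible in \<open>D\<close>, so principal ideals have this property. Conversely \<open>\<nabla>A\<close> has supremum \<open>A\<close>
  and is closed irreducible when \<open>D\<close> is dominated, and \<open>A \<in> \<nabla>A\<close> forces \<open>A\<close> to be principal.
\<close>

section \<open>Suprema and Scott-closed sets relative to a carrier\<close>

lemma isLub_iff:
  "isLub P S x \<longleftrightarrow> x \<in> P \<and> (\<forall>s\<in>S. s \<le> x) \<and> (\<forall>u\<in>P. (\<forall>s\<in>S. s \<le> u) \<longrightarrow> x \<le> u)"
  unfolding isLub_def leastP_def isUb_def setle_def setge_def by auto

lemma Scott_closedI:
  assumes "A \<subseteq> P"
    and "\<And>x y. x \<in> A \<Longrightarrow> y \<in> P \<Longrightarrow> y \<le> x \<Longrightarrow> y \<in> A"
    and "\<And>S x. S \<subseteq> A \<Longrightarrow> directed S \<Longrightarrow> isLub P S x \<Longrightarrow> x \<in> A"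
  shows "Scott_closed P A"
  using assms unfolding Scott_closed_def by blast

lemma Scott_closed_subset: "Scott_closed P A \<Longrightarrow> A \<subseteq> P"
  unfolding Scott_closed_def by blast

lemma Scott_closed_lower: "Scott_closed P A \<Longrightarrow> x \<in> A \<Longrightarrow> y \<in> P \<Longrightarrow> y \<le> x \<Longrightarrow> y \<in> A"
  unfolding Scott_closed_def by blast

lemma Scott_closed_lub:
  "Scott_closed P A \<Longrightarrow> S \<subseteq> A \<Longrightarrow> directed S \<Longrightarrow> isLub P S x \<Longrightarrow> x \<in> A"
  unfolding Scott_closed_def by blast

section \<open>Transport along order embeddings\<close>

locale order_embedding =
  fixes f :: "'a::order \<Rightarrow> 'b::order" and P :: "'a set"
  assumes le_iff: "x \<in> P \<Longrightarrow> y \<in> P \<Longrightarrow> f x \<le> f y \<longleftrightarrow> x \<le> y"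
begin

lemma inj: "inj_on f P"
  by (rule inj_onI) (metis le_iff order.antisym order.refl)

lemma mem_image_iff: "A \<subseteq> P \<Longrightarrow> x \<in> P \<Longrightarrow> f x \<in> f ` A \<longleftrightarrow> x \<in> A"
  using inj by (meson inj_on_image_mem_iff)

lemma image_subset_iff': "A \<subseteq> P \<Longrightarrow> B \<subseteq> P \<Longrightarrow> f ` A \<subseteq> f ` B \<longleftrightarrow> A \<subseteq> B"
  unfolding image_subset_iff using mem_image_iff by blast

lemma directed_image:
  assumes "S \<subseteq> P"
  shows "directed (f ` S) \<longleftrightarrow> directed S"
  unfolding directed_def using assms by (auto simp: le_iff subset_iff)

lemma isLub_image:
  assumes "S \<subseteq> P" "x \<in> P"
  shows "isLub (f ` P) (f ` S) (f x) \<longleftrightarrow> isLub P S x"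
  unfolding isLub_iff using assms by (auto simp: le_iff subset_iff)

lemma Scott_closed_image:
  assumes "A \<subseteq> P"
  shows "Scott_closed (f ` P) (f ` A) \<longleftrightarrow> Scott_closed P A"
proof
  assume cl: "Scott_closed (f ` P) (f ` A)"
  show "Scott_closed P A"
  proof (rule Scott_closedI)
    fix x y assume "x \<in> A" "y \<in> P" "y \<le> x"
    then show "y \<in> A"
      using Scott_closed_lower[OF cl, of "f x" "f y"] assms mem_image_iff le_iff by blast
  next
    fix S x assume S: "S \<subseteq> A" "directed S" "isLub P S x"
    then have "x \<in> P" "S \<subseteq> P"
      using assms by (auto simp: isLub_iff)
    then show "x \<in> A"
      using Scott_closed_lub[OF cl, of "f ` S" "f x"] S assms
      by (simp add: directed_image isLub_image mem_image_iff image_mono)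
  qed (fact assms)
next
  assume cl: "Scott_closed P A"
  show "Scott_closed (f ` P) (f ` A)"
  proof (rule Scott_closedI)
    fix x y assume "x \<in> f ` A" "y \<in> f ` P" "y \<le> x"
    then show "y \<in> f ` A"
      using Scott_closed_lower[OF cl] assms le_iff by blast
  next
    fix T y assume T: "T \<subseteq> f ` A" "directed T" "isLub (f ` P) T y"
    obtain S where S: "S \<subseteq> A" "T = f ` S"
      using T(1) by (meson subset_imageE)
    obtain x where x: "x \<in> P" "y = f x"
      using T(3) by (auto simp: isLub_iff)
    have "S \<subseteq> P" using S assms by blast
    then have "x \<in> A"
      using Scott_closed_lub[OF cl S(1)] T S x by (simp add: directed_image isLub_image)
    then show "y \<in> f ` A" using x by blast
  qed (use assms in blast)
qed

text \<open>A closed subset of \<open>f\<close> P\<open>lies in\<close>f \<open>P\<close>, so it is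
  the image of a subset of \<open>P\<close>, itself closed by \<open>Scott_closed_image\<close>.
  This pulls the quantifiers in \<open>irreducible_in\<close> back to \<open>P\<close>.\<close>

lemma all_Scott_closed_image:
  "(\<forall>B. Scott_closed (f ` P) B \<longrightarrow> Q B) \<longleftrightarrow> (\<forall>B. Scott_closed P B \<longrightarrow> Q (f ` B))"
  by (metis Scott_closed_image Scott_closed_subset subset_imageE)

lemma irreducible_in_image:
  assumes "A \<subseteq> P"
  shows "irreducible_in (f ` P) (f ` A) \<longleftrightarrow> irreducible_in P A"
proof -
  have "(f ` A \<subseteq> f ` B \<union> f ` C \<longrightarrow> f ` A \<subseteq> f ` B \<or> f ` A \<subseteq> f ` C)
      \<longleftrightarrow> (A \<subseteq> B \<union> C \<longrightarrow> A \<subseteq> B \<or> A \<subseteq> C)"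
    if "Scott_closed P B" "Scott_closed P C" for B C
    using that[THEN Scott_closed_subset] assms
    by (simp add: image_subset_iff' flip: image_Un)
  then show ?thesis
    unfolding irreducible_in_def
    using assms by (simp add: image_mono all_Scott_closed_image imp_conjL cong: imp_cong)
qed

lemma Gam_image: "\<Gamma> (f ` P) = image f ` \<Gamma> P"
  unfolding Gam_def
  by (auto simp: Scott_closed_image Scott_closed_subset)
     (metis Scott_closed_image Scott_closed_subset image_eqI mem_Collect_eq subset_imageE)

lemma Irr_image: "Irr (f ` P) = image f ` Irr P"
proof -
  have "Irr (f ` P) = {A \<in> \<Gamma> (f ` P). irreducible_in (f ` P) A}"
    by (auto simp: Irr_def Gam_def)
  also have "\<dots> = image f ` {A \<in> \<Gamma> P. irreducible_in P A}"
    unfolding Gam_image by (auto simp: Gam_def irreducible_in_image Scott_closed_subset)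
  also have "{A \<in> \<Gamma> P. irreducible_in P A} = Irr P"
    by (auto simp: Irr_def Gam_def)
  finally show ?thesis .
qed

text \<open>Moves one level up, from a poset to a family of its subsets ordered by inclusion, as
  needed for \<open>\<Gamma> P\<close>.\<close>

lemma order_embedding_image: "\<A> \<subseteq> Pow P \<Longrightarrow> order_embedding (image f) \<A>"
  by unfold_locales (metis PowD image_subset_iff' subsetD)

end

lemma order_isomorphic_iff: "P \<cong>\<^sub>o Q \<longleftrightarrow> (\<exists>f. order_embedding f P \<and> Q = f ` P)"
proof
  assume "P \<cong>\<^sub>o Q"
  then show "\<exists>f. order_embedding f P \<and> Q = f ` P"
    unfolding order_isomorphic_def order_embedding_def bij_betw_def by metis
next
  assume "\<exists>f. order_embedding f P \<and> Q = f ` P"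
  then show "P \<cong>\<^sub>o Q"
    unfolding order_isomorphic_def bij_betw_def
    using order_embedding.inj order_embedding.le_iff by metis
qed

lemma order_isomorphic_sym:
  assumes "P \<cong>\<^sub>o Q"
  shows "Q \<cong>\<^sub>o P"
proof -
  obtain f where f: "order_embedding f P" "Q = f ` P"
    using assms by (auto simp: order_isomorphic_iff)
  interpret order_embedding f P by fact
  have "order_embedding (inv_into P f) Q" "P = inv_into P f ` Q"
    unfolding f(2) using inj by (auto simp: order_embedding_def le_iff)
  then show ?thesis by (auto simp: order_isomorphic_iff)
qed

lemma order_isomorphic_trans:
  assumes "P \<cong>\<^sub>o Q" "Q \<cong>\<^sub>o R"
  shows "P \<cong>\<^sub>o R"
proof -
  obtain f g where "order_embedding f P" "Q = f ` P" "order_embedding g Q" "R = g ` Q"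
    using assms by (auto simp: order_isomorphic_iff)
  then have "order_embedding (g \<circ> f) P" "R = (g \<circ> f) ` P"
    by (auto simp: order_embedding_def image_comp)
  then show ?thesis by (auto simp: order_isomorphic_iff)
qed

lemma order_isomorphic_subsets:
  assumes "order_embedding f P" "A \<subseteq> P"
  shows "A \<cong>\<^sub>o f ` A"
  using assms unfolding order_isomorphic_iff order_embedding_def by blast

lemma order_isomorphic_Gam:
  assumes "P \<cong>\<^sub>o Q"
  shows "\<Gamma> P \<cong>\<^sub>o \<Gamma> Q"
proof -
  obtain f where f: "order_embedding f P" "Q = f ` P"
    using assms by (auto simp: order_isomorphic_iff)
  have "\<Gamma> P \<subseteq> Pow P" by (auto simp: Gam_def Scott_closed_def)
  then show ?thesis
    using order_embedding.order_embedding_image[OF f(1)] order_embedding.Gam_image[OF f(1)] f(2)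
    unfolding order_isomorphic_iff by blast
qed

section \<open>Irreducible closed sets as join-primes\<close>

text \<open>
  Avoiding joins keeps the notion meaningful in any poset; the existence of some \<open>b\<close> not
  above \<open>a\<close> excludes the least element.
\<close>

definition join_primes :: "'a::order set \<Rightarrow> 'a set" where
  "join_primes P = {a \<in> P. (\<exists>b\<in>P. \<not> a \<le> b) \<and>
     (\<forall>b\<in>P. \<forall>c\<in>P. (\<forall>u\<in>P. b \<le> u \<longrightarrow> c \<le> u \<longrightarrow> a \<le> u) \<longrightarrow> a \<le> b \<or> a \<le> c)}"

lemma (in order_embedding) join_primes_image: "join_primes (f ` P) = f ` join_primes P"
proof -
  have "f a \<in> join_primes (f ` P) \<longleftrightarrow> a \<in> join_primes P" if "a \<in> P" for a
    using that unfolding join_primes_def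
    by (simp add: le_iff mem_image_iff cong: ball_cong bex_cong)
  moreover have "join_primes (f ` P) \<subseteq> f ` P" "join_primes P \<subseteq> P"
    by (auto simp: join_primes_def)
  ultimately show ?thesis by blast
qed

lemma order_isomorphic_join_primes:
  assumes "P \<cong>\<^sub>o Q"
  shows "join_primes P \<cong>\<^sub>o join_primes Q"
proof -
  obtain f where f: "order_embedding f P" "Q = f ` P"
    using assms by (auto simp: order_isomorphic_iff)
  have "join_primes P \<subseteq> P" by (auto simp: join_primes_def)
  then show ?thesis
    using order_isomorphic_subsets[OF f(1)] order_embedding.join_primes_image[OF f(1)] f(2)
    by metis
qed

text \<open>
  Either \<open>S \<inter> B\<close> is cofinal in \<open>S\<close>, or some tail of \<open>S\<close> misses \<open>B\<close> and hence lies in \<open>C\<close>.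
\<close>

lemma Scott_closed_Un:
  assumes B: "Scott_closed P B" and C: "Scott_closed P C"
  shows "Scott_closed P (B \<union> C)"
proof (rule Scott_closedI)
  show "B \<union> C \<subseteq> P" using assms by (simp add: Scott_closed_subset)
next
  fix x y assume "x \<in> B \<union> C" "y \<in> P" "y \<le> x"
  then show "y \<in> B \<union> C" using Scott_closed_lower[OF B] Scott_closed_lower[OF C] by blast
next
  fix S x assume S: "S \<subseteq> B \<union> C" "directed S" "isLub P S x"
  show "x \<in> B \<union> C"
  proof (cases "\<forall>s\<in>S. \<exists>t\<in>S \<inter> B. s \<le> t")
    case True
    have "directed (S \<inter> B)"
      unfolding directed_def
    proof (intro conjI ballI)
      show "S \<inter> B \<noteq> {}" using S(2) True unfolding directed_def by blast
    next
      fix y z assume "y \<in> S \<inter> B" "z \<in> S \<inter> B"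
      then obtain s where "s \<in> S" "y \<le> s" "z \<le> s" using S(2) unfolding directed_def by blast
      then show "\<exists>t\<in>S \<inter> B. y \<le> t \<and> z \<le> t" using True order.trans by metis
    qed
    moreover have "isLub P (S \<inter> B) x"
      using S(3) True unfolding isLub_iff by (meson IntD1 order.trans)
    ultimately show ?thesis using Scott_closed_lub[OF B, of "S \<inter> B"] by blast
  next
    case False
    then obtain s where s: "s \<in> S" "\<And>t. t \<in> S \<Longrightarrow> s \<le> t \<Longrightarrow> t \<notin> B" by blast
    let ?T = "{t \<in> S. s \<le> t}"
    have cof: "\<exists>t\<in>?T. r \<le> t" if "r \<in> S" for r
      using S(2) s(1) that unfolding directed_def by blast
    have "directed ?T"
      unfolding directed_def
    proof (intro conjI ballI)
      show "?T \<noteq> {}" using s(1) by blast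
    next
      fix y z assume "y \<in> ?T" "z \<in> ?T"
      then obtain t where "t \<in> S" "y \<le> t" "z \<le> t" "s \<le> y"
        using S(2) unfolding directed_def by blast
      then show "\<exists>t\<in>?T. y \<le> t \<and> z \<le> t" using order.trans by blast
    qed
    moreover have "isLub P ?T x"
      using S(3) cof unfolding isLub_iff by (smt (verit) mem_Collect_eq order.trans)
    moreover have "?T \<subseteq> C" using S(1) s(2) by blast
    ultimately show ?thesis using Scott_closed_lub[OF C] by blast
  qed
qed

lemma Scott_closed_empty: "Scott_closed P {}"
  by (rule Scott_closedI) (auto simp: directed_def)

text \<open>Unions of two closed sets are closed, so they are the binary joins of
  \<open>\<Gamma> P\<close>, and being below every common upper bound of \<open>B\<close> and
  \<open>C\<close> means being contained in \<open>B \<union> C\<close>. The least element is the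
  empty set, which matches the nonemptiness required of irreducible sets.\<close>

lemma join_primes_Gam: "join_primes (\<Gamma> P) = Irr P"
proof (rule set_eqI)
  fix A
  have ex: "(\<exists>B\<in>\<Gamma> P. \<not> A \<subseteq> B) \<longleftrightarrow> A \<noteq> {}"
    using Scott_closed_empty by (auto simp: Gam_def)
  have un: "(\<forall>U\<in>\<Gamma> P. B \<subseteq> U \<longrightarrow> C \<subseteq> U \<longrightarrow> A \<subseteq> U) \<longleftrightarrow> A \<subseteq> B \<union> C"
    if "B \<in> \<Gamma> P" "C \<in> \<Gamma> P" for B C
    using that Scott_closed_Un[of P B C] by (auto simp: Gam_def)
  show "A \<in> join_primes (\<Gamma> P) \<longleftrightarrow> A \<in> Irr P"
    unfolding join_primes_def Irr_def irreducible_in_def mem_Collect_eq ex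
    using un Scott_closed_subset[of P A] by (auto simp: Gam_def)
qed

section \<open>Principal ideals among the irreducible closed sets\<close>

lemma Irr_subset: "A \<in> Irr P \<Longrightarrow> A \<subseteq> P"
  by (simp add: Irr_def Scott_closed_subset)

lemma Irr_D: "A \<in> Irr P \<Longrightarrow> Scott_closed P B \<Longrightarrow> Scott_closed P C \<Longrightarrow> A \<subseteq> B \<union> C \<Longrightarrow> A \<subseteq> B \<or> A \<subseteq> C"
  by (simp add: Irr_def irreducible_in_def)

definition down :: "'a::order set \<Rightarrow> 'a \<Rightarrow> 'a set" where
  "down P x = {y \<in> P. y \<le> x}"

lemma down_subset_iff:
  assumes "Scott_closed P A" "x \<in> P"
  shows "down P x \<subseteq> A \<longleftrightarrow> x \<in> A"
  using assms Scott_closed_lower by (fastforce simp: down_def)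

lemma Scott_closed_down: "x \<in> P \<Longrightarrow> Scott_closed P (down P x)"
  by (rule Scott_closedI) (auto simp: down_def isLub_iff)

lemma down_in_Irr:
  assumes "x \<in> P"
  shows "down P x \<in> Irr P"
proof -
  \<comment> \<open>If \<open>B\<close> and \<open>C\<close> cover the ideal, one of them contains
    \<open>x\<close>, and a closed set containing \<open>x\<close> contains the whole ideal.\<close>
  have "x \<in> down P x" using assms by (simp add: down_def)
  then show ?thesis
    using Scott_closed_down[OF assms] down_subset_iff[OF _ assms]
    unfolding Irr_def irreducible_in_def
    by (auto simp: Scott_closed_subset)
qed

lemma order_embedding_down: "order_embedding (down P) P"
  by unfold_locales (simp add: down_subset_iff Scott_closed_down, simp add: down_def)

lemma order_isomorphic_down: "P \<cong>\<^sub>o down P ` P"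
  using order_embedding_down by (auto simp: order_isomorphic_iff)

text \<open>The monotone map \<open>down P\<close> carries each directed supremum existing in
  \<open>P\<close> to a supremum in \<open>Irr P\<close>: a closed set containing every element of
  \<open>S\<close> contains its supremum. Hence preimages of closed sets are closed.\<close>

lemma Scott_closed_down_vimage:
  assumes cl: "Scott_closed (Irr P) \<C>"
  shows "Scott_closed P {x \<in> P. down P x \<in> \<C>}"
proof (rule Scott_closedI)
  interpret order_embedding "down P" P by (rule order_embedding_down)
  fix x y assume "x \<in> {x \<in> P. down P x \<in> \<C>}" "y \<in> P" "y \<le> x"
  then show "y \<in> {x \<in> P. down P x \<in> \<C>}"
    using Scott_closed_lower[OF cl _ down_in_Irr] le_iff by blast
next
  interpret order_embedding "down P" P by (rule order_embedding_down)
  fix S x assume S: "S \<subseteq> {x \<in> P. down P x \<in> \<C>}" "directed S" "isLub P S x"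
  then have sub: "S \<subseteq> P" and x: "x \<in> P" by (auto simp: isLub_iff)
  have "isLub (Irr P) (down P ` S) (down P x)"
    unfolding isLub_iff
  proof (intro conjI ballI impI)
    fix T assume "T \<in> down P ` S"
    then show "T \<le> down P x"
      using S(3) sub x le_iff unfolding isLub_iff by blast
  next
    fix U assume U: "U \<in> Irr P" "\<forall>s\<in>down P ` S. s \<subseteq> U"
    then have cU: "Scott_closed P U" by (simp add: Irr_def)
    have "S \<subseteq> U" using U(2) sub down_subset_iff[OF cU] by blast
    then have "x \<in> U" using Scott_closed_lub[OF cU] S by blast
    then show "down P x \<subseteq> U" using down_subset_iff[OF cU x] by blast
  qed (rule down_in_Irr[OF x])
  moreover have "directed (down P ` S)" using directed_image[OF sub] S(2) by blast
  moreover have "down P ` S \<subseteq> \<C>" using S(1) by blast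
  ultimately show "x \<in> {x \<in> P. down P x \<in> \<C>}"
    using Scott_closed_lub[OF cl] x by blast
qed blast

text \<open>Since \<open>\<C>\<close> is a lower set, \<open>x \<in> A \<in> \<C>\<close> puts
  \<open>down P x\<close> into \<open>\<C>\<close>. Combined with
  \<open>Scott_closed_down_vimage\<close>, this makes \<open>\<Union>\<C>\<close>
  Scott-closed.\<close>

lemma Union_eq_down_vimage:
  assumes cl: "Scott_closed (Irr P) \<C>"
  shows "\<Union>\<C> = {x \<in> P. down P x \<in> \<C>}"
proof (intro equalityI subsetI)
  fix x assume "x \<in> \<Union>\<C>"
  then obtain A where A: "x \<in> A" "A \<in> \<C>" by blast
  then have "A \<in> Irr P" using Scott_closed_subset[OF cl] by blast
  then have "x \<in> P" "down P x \<subseteq> A"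
    using A(1) Irr_subset down_subset_iff[of P A x] by (auto simp: Irr_def)
  then show "x \<in> {x \<in> P. down P x \<in> \<C>}"
    using Scott_closed_lower[OF cl A(2) down_in_Irr] by blast
next
  fix x assume "x \<in> {x \<in> P. down P x \<in> \<C>}"
  then have "x \<in> down P x" "down P x \<in> \<C>" by (auto simp: down_def)
  then show "x \<in> \<Union>\<C>" by blast
qed

section \<open>Closures and unions of families of irreducible closed sets\<close>

lemma Scott_closure:
  assumes "S \<subseteq> P"
  shows "Scott_closed P (\<Inter>{B. Scott_closed P B \<and> S \<subseteq> B})"
proof (rule Scott_closedI)
  \<comment> \<open>\<open>P\<close> is itself a member of the intersected family, which keeps the
    intersection inside \<open>P\<close>.\<close>
  have "Scott_closed P P" by (rule Scott_closedI) (auto simp: isLub_iff)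
  then show "\<Inter>{B. Scott_closed P B \<and> S \<subseteq> B} \<subseteq> P" using assms by blast
next
  fix x y assume "x \<in> \<Inter>{B. Scott_closed P B \<and> S \<subseteq> B}" "y \<in> P" "y \<le> x"
  then show "y \<in> \<Inter>{B. Scott_closed P B \<and> S \<subseteq> B}"
    using Scott_closed_lower by blast
next
  fix T x assume T: "T \<subseteq> \<Inter>{B. Scott_closed P B \<and> S \<subseteq> B}" "directed T" "isLub P T x"
  have "x \<in> B" if B: "Scott_closed P B" "S \<subseteq> B" for B
    using Scott_closed_lub[OF B(1) _ T(2,3)] T(1) B by blast
  then show "x \<in> \<Inter>{B. Scott_closed P B \<and> S \<subseteq> B}" by blast
qed

text \<open>If the union were in neither \<open>B\<close> nor \<open>C\<close>, two members would
  witness this, and a common upper bound of them in \<open>\<S>\<close> would violate its own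
  irreducibility. The closure then inherits irreducibility from the union.\<close>

lemma closure_directed_Union_in_Irr:
  assumes S: "\<S> \<subseteq> Irr P" and dir: "directed \<S>"
  shows "\<Inter>{B. Scott_closed P B \<and> \<Union>\<S> \<subseteq> B} \<in> Irr P" (is "?K \<in> _")
proof -
  have "\<Union>\<S> \<subseteq> P" using S Irr_subset[of _ P] by auto
  then have clK: "Scott_closed P ?K" by (rule Scott_closure)
  obtain A where "A \<in> \<S>" using dir by (auto simp: directed_def)
  then have "A \<noteq> {}" "A \<subseteq> ?K" using S by (auto simp: Irr_def irreducible_in_def)
  then have "?K \<noteq> {}" by blast
  moreover have "?K \<subseteq> B \<or> ?K \<subseteq> C"
    if BC: "Scott_closed P B" "Scott_closed P C" "?K \<subseteq> B \<union> C" for B C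
  proof -
    have "\<Union>\<S> \<subseteq> B \<or> \<Union>\<S> \<subseteq> C"
    proof (rule ccontr)
      assume "\<not> ?thesis"
      then obtain A1 A2 where A12: "A1 \<in> \<S>" "\<not> A1 \<subseteq> B" "A2 \<in> \<S>" "\<not> A2 \<subseteq> C" by blast
      then obtain A where A: "A \<in> \<S>" "A1 \<subseteq> A" "A2 \<subseteq> A"
        using dir unfolding directed_def by blast
      have "A \<subseteq> B \<union> C" using A(1) BC(3) by blast
      then show False using Irr_D[OF _ BC(1,2), of A] A A12 S by blast
    qed
    then show ?thesis using BC(1,2) by blast
  qed
  ultimately show ?thesis
    using clK Scott_closed_subset[OF clK] by (simp add: Irr_def irreducible_in_def)
qed

text \<open>The closure of the union of a directed family is an upper bound within
  \<open>Irr P\<close>, so a supremum there cannot leave a closed set \<open>B\<close> containing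
  all members.\<close>

lemma Scott_closed_Irr_below:
  assumes B: "Scott_closed P B"
  shows "Scott_closed (Irr P) {A \<in> Irr P. A \<subseteq> B}"
proof (rule Scott_closedI)
  fix \<S> X assume S: "\<S> \<subseteq> {A \<in> Irr P. A \<subseteq> B}" "directed \<S>" "isLub (Irr P) \<S> X"
  let ?K = "\<Inter>{C. Scott_closed P C \<and> \<Union>\<S> \<subseteq> C}"
  have "\<S> \<subseteq> Irr P" using S(1) by blast
  then have "?K \<in> Irr P" using S(2) by (rule closure_directed_Union_in_Irr)
  moreover have "\<forall>A\<in>\<S>. A \<subseteq> ?K" by blast
  ultimately have "X \<subseteq> ?K" using S(3) by (simp add: isLub_iff)
  also have "?K \<subseteq> B" using B S(1) by blast
  finally show "X \<in> {A \<in> Irr P. A \<subseteq> B}" using S(3) by (simp add: isLub_iff)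
qed auto

text \<open>Irreducibility is used at two levels. Given a cover of \<open>\<Union>\<C>\<close> by
  \<open>B1\<close> and \<open>B2\<close>, each member of \<open>\<C>\<close> lies in one of them;
  this covers \<open>\<C>\<close> by two closed subsets of \<open>Irr P\<close>, one of which must
  contain \<open>\<C>\<close>.\<close>

lemma Union_in_Irr:
  assumes C: "\<C> \<in> Irr (Irr P)"
  shows "\<Union>\<C> \<in> Irr P"
proof -
  have cl: "Scott_closed (Irr P) \<C>" and "\<C> \<noteq> {}"
    using C by (auto simp: Irr_def[of "Irr P"] irreducible_in_def)
  have clU: "Scott_closed P (\<Union>\<C>)"
    using Scott_closed_down_vimage[OF cl] Union_eq_down_vimage[OF cl] by simp
  obtain A where "A \<in> \<C>" using \<open>\<C> \<noteq> {}\<close> by blast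
  then have "A \<noteq> {}"
    using Scott_closed_subset[OF cl] by (auto simp: Irr_def irreducible_in_def)
  then have "\<Union>\<C> \<noteq> {}" using \<open>A \<in> \<C>\<close> by blast
  moreover have "\<Union>\<C> \<subseteq> B1 \<or> \<Union>\<C> \<subseteq> B2"
    if B: "Scott_closed P B1" "Scott_closed P B2" and sub: "\<Union>\<C> \<subseteq> B1 \<union> B2" for B1 B2
  proof -
    have "\<C> \<subseteq> {A \<in> Irr P. A \<subseteq> B1} \<union> {A \<in> Irr P. A \<subseteq> B2}"
    proof
      fix A assume A: "A \<in> \<C>"
      then have "A \<in> Irr P" "A \<subseteq> B1 \<union> B2" using Scott_closed_subset[OF cl] sub by blast+
      then show "A \<in> {A \<in> Irr P. A \<subseteq> B1} \<union> {A \<in> Irr P. A \<subseteq> B2}"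
        using Irr_D[OF _ B] by blast
    qed
    then have "\<C> \<subseteq> {A \<in> Irr P. A \<subseteq> B1} \<or> \<C> \<subseteq> {A \<in> Irr P. A \<subseteq> B2}"
      using Irr_D[OF C] B[THEN Scott_closed_Irr_below] by blast
    then show ?thesis by blast
  qed
  ultimately show ?thesis
    using clU Scott_closed_subset[OF clU] by (simp add: Irr_def irreducible_in_def)
qed

section \<open>The families \<open>nabla P A\<close>\<close>

lemma nabla_eq:
  assumes "A \<in> Irr P"
  shows "nabla P A = {B \<in> Irr P. \<exists>x\<in>A. B \<subseteq> down P x}"
  by (auto simp: nabla_def below_in_def down_def)

lemma down_in_nabla: "A \<in> Irr P \<Longrightarrow> x \<in> A \<Longrightarrow> down P x \<in> nabla P A"
  using Irr_subset[of A P] down_in_Irr[of x P] by (auto simp: nabla_eq)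

text \<open>The ideals \<open>down P x\<close> with \<open>x \<in> A\<close> belong to the family
  and already cover \<open>A\<close>.\<close>

lemma isLub_nabla:
  assumes A: "A \<in> Irr P"
  shows "isLub (Irr P) (nabla P A) A"
  unfolding isLub_iff
proof (intro conjI ballI impI)
  fix B assume "B \<in> nabla P A"
  then show "B \<subseteq> A"
    using A Scott_closed_lower[of P A] by (fastforce simp: nabla_eq down_def Irr_def)
next
  fix U assume U: "\<forall>B\<in>nabla P A. B \<subseteq> U"
  have "x \<in> down P x" if "x \<in> A" for x
    using that Irr_subset[OF A] by (auto simp: down_def)
  then show "A \<subseteq> U" using U down_in_nabla[OF A] by blast
qed (fact A)

text \<open>A cover of \<open>nabla P A\<close> pulls back along \<open>down P\<close> to a cover of
  \<open>A\<close> by closed sets, where irreducibility of \<open>A\<close> applies.\<close>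

lemma nabla_in_Irr:
  assumes A: "A \<in> Irr P" and cl: "Scott_closed (Irr P) (nabla P A)"
  shows "nabla P A \<in> Irr (Irr P)"
proof -
  have "A \<noteq> {}" using A by (simp add: Irr_def irreducible_in_def)
  then have "nabla P A \<noteq> {}" using down_in_nabla[OF A] by blast
  moreover have "nabla P A \<subseteq> \<B> \<or> nabla P A \<subseteq> \<C>"
    if BC: "Scott_closed (Irr P) \<B>" "Scott_closed (Irr P) \<C>" "nabla P A \<subseteq> \<B> \<union> \<C>" for \<B> \<C>
  proof -
    \<comment> \<open>Every member of \<open>nabla P A\<close> lies below some
      \<open>down P x\<close> with \<open>x \<in> A\<close>, and \<open>\<D>\<close> is a lower
      set.\<close>
    have *: "nabla P A \<subseteq> \<D>" if "Scott_closed (Irr P) \<D>" "A \<subseteq> {x \<in> P. down P x \<in> \<D>}" for \<D>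
      using that Scott_closed_lower[OF that(1)] by (auto simp: nabla_eq[OF A])
    have "A \<subseteq> {x \<in> P. down P x \<in> \<B>} \<union> {x \<in> P. down P x \<in> \<C>}"
      using down_in_nabla[OF A] BC(3) Irr_subset[OF A] by blast
    then have "A \<subseteq> {x \<in> P. down P x \<in> \<B>} \<or> A \<subseteq> {x \<in> P. down P x \<in> \<C>}"
      using Irr_D[OF A] BC(1,2)[THEN Scott_closed_down_vimage] by blast
    then show ?thesis using * BC(1,2) by blast
  qed
  ultimately show ?thesis
    using cl Scott_closed_subset[OF cl]
    by (simp add: Irr_def[of "Irr P"] irreducible_in_def[of "Irr P"])
qed

text \<open>An analogue of compactness with closed irreducible sets in place of directed sets. Being
  phrased by order alone, it is preserved by isomorphisms.\<close>

definition Irr_compacts :: "'a::order set \<Rightarrow> 'a set" where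
  "Irr_compacts P = {a \<in> P. \<forall>C\<in>Irr P. \<forall>x\<in>P. isLub P C x \<longrightarrow> a \<le> x \<longrightarrow> a \<in> C}"

lemma (in order_embedding) Irr_compacts_image: "Irr_compacts (f ` P) = f ` Irr_compacts P"
proof -
  have "(isLub (f ` P) (f ` C) (f x) \<longrightarrow> f a \<le> f x \<longrightarrow> f a \<in> f ` C)
      \<longleftrightarrow> (isLub P C x \<longrightarrow> a \<le> x \<longrightarrow> a \<in> C)" if "a \<in> P" "C \<in> Irr P" "x \<in> P" for a C x
    using that Irr_subset[OF that(2)] by (simp add: isLub_image le_iff mem_image_iff)
  then have "f a \<in> Irr_compacts (f ` P) \<longleftrightarrow> a \<in> Irr_compacts P" if "a \<in> P" for a
    using that mem_image_iff[of P] unfolding Irr_compacts_def Irr_image by (simp cong: ball_cong)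
  moreover have "Irr_compacts (f ` P) \<subseteq> f ` P" "Irr_compacts P \<subseteq> P"
    by (auto simp: Irr_compacts_def)
  ultimately show ?thesis by blast
qed

lemma order_isomorphic_Irr_compacts:
  assumes "P \<cong>\<^sub>o Q"
  shows "Irr_compacts P \<cong>\<^sub>o Irr_compacts Q"
proof -
  obtain f where f: "order_embedding f P" "Q = f ` P"
    using assms by (auto simp: order_isomorphic_iff)
  have "Irr_compacts P \<subseteq> P" by (auto simp: Irr_compacts_def)
  then show ?thesis
    using order_isomorphic_subsets[OF f(1)] order_embedding.Irr_compacts_image[OF f(1)] f(2)
    by metis
qed

lemma down_in_Irr_compacts:
  assumes x: "x \<in> P"
  shows "down P x \<in> Irr_compacts (Irr P)"
  unfolding Irr_compacts_def
proof (intro CollectI conjI ballI impI)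
  fix \<C> X assume C: "\<C> \<in> Irr (Irr P)" "isLub (Irr P) \<C> X" "down P x \<subseteq> X"
  have cl: "Scott_closed (Irr P) \<C>" using C(1) by (simp add: Irr_def[of "Irr P"])
  \<comment> \<open>The union is itself an element of \<open>Irr P\<close>, hence an upper bound
    with which the supremum \<open>X\<close> can be compared.\<close>
  have "X \<subseteq> \<Union>\<C>" using C(2) Union_in_Irr[OF C(1)] unfolding isLub_iff by blast
  then have "x \<in> \<Union>\<C>" using C(3) x by (auto simp: down_def)
  then show "down P x \<in> \<C>" using Union_eq_down_vimage[OF cl] by blast
qed (rule down_in_Irr[OF x])

lemma Irr_compacts_Irr:
  assumes "dominated P"
  shows "Irr_compacts (Irr P) = down P ` P"
proof (intro equalityI subsetI)
  fix A assume comp: "A \<in> Irr_compacts (Irr P)"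
  then have A: "A \<in> Irr P" by (simp add: Irr_compacts_def)
  then have "nabla P A \<in> Irr (Irr P)"
    using nabla_in_Irr assms by (auto simp: dominated_def)
  \<comment> \<open>The compactness property is applied to \<open>nabla P A\<close> and to its
    supremum, which is \<open>A\<close> itself.\<close>
  then have "A \<in> nabla P A"
    using comp isLub_nabla[OF A] A by (auto simp: Irr_compacts_def)
  then obtain x where x: "x \<in> A" "A \<subseteq> down P x" by (auto simp: nabla_eq[OF A])
  have "x \<in> P" using x(1) Irr_subset[OF A] by blast
  moreover have "down P x \<subseteq> A"
    using down_subset_iff[OF _ \<open>x \<in> P\<close>] A x(1) by (simp add: Irr_def)
  ultimately show "A \<in> down P ` P" using x(2) by blast
qed (use down_in_Irr_compacts in blast)

theorem theorem2p13:
  fixes D :: "'a::order set" and E :: "'b::order set"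
  assumes "dcpo D" and "dominated D"
    and "dcpo E" and "dominated E"
  shows "(D \<cong>\<^sub>o E \<longleftrightarrow> \<Gamma> D \<cong>\<^sub>o \<Gamma> E) \<and> (\<Gamma> D \<cong>\<^sub>o \<Gamma> E \<longleftrightarrow> Irr D \<cong>\<^sub>o Irr E)"
proof -
  have "\<Gamma> D \<cong>\<^sub>o \<Gamma> E" if "D \<cong>\<^sub>o E"
    using that by (rule order_isomorphic_Gam)
  moreover have "Irr D \<cong>\<^sub>o Irr E" if "\<Gamma> D \<cong>\<^sub>o \<Gamma> E"
    using order_isomorphic_join_primes[OF that] by (simp add: join_primes_Gam)
  moreover have "D \<cong>\<^sub>o E" if "Irr D \<cong>\<^sub>o Irr E"
  proof -
    \<comment> \<open>An isomorphism of the \<open>Irr\<close> posets restricts to their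
      \<open>Irr_compacts\<close>, which are the copies of \<open>D\<close> and \<open>E\<close> by
      principal ideals.\<close>
    have "down D ` D \<cong>\<^sub>o down E ` E"
      using order_isomorphic_Irr_compacts[OF that] assms(2,4) by (simp add: Irr_compacts_Irr)
    then show ?thesis
      by (meson order_isomorphic_down order_isomorphic_sym order_isomorphic_trans)
  qed
  ultimately show ?thesis by blast
qed

end
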